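(* Let $N\ge 3$ and let $p,q$ satisfy $p,q\le \frac{N+2}{N-2}$. Let $(u,v)\in H^{1}(\mathbb{H}^{N})\times H^{1}(\mathbb{H}^{N})$ be a positive radial solution of the system $$-\Delta_{\mathbb{H}^{N}}u=|v|^{p-1}v,\qquad -\Delta_{\mathbb{H}^{N}}v=|u|^{q-1}u\qquad\text{on } \mathbb{H}^{N},$$ and write $u=u(r)$, $v=v(r)$, where $r\ge 0$ is the hyperbolic distance to the center of symmetry. Then $u'(r)<0$ and $v'(r)<0$ for $r>0$, and $$\lim_{r\to\infty}u(r)=\lim_{r\to\infty}v(r)=\lim_{r\to\infty}u'(r)=\lim_{r\to\infty}v'(r)=0.$$ Moreover, $$\lim_{r\to\infty}\frac{\log u(r)^{2}}{r}=\lim_{r\to\infty}\frac{\log v(r)^{2}}{r}=\lim_{r\to\infty}\frac{\log u'(r)^{2}}{r}=\lim_{r\to\infty}\frac{\log v'(r)^{2}}{r}=-2(N-1).$$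
   Context: $\mathbb{H}^N$ is the $N$-dimensional hyperbolic space of constant sectional curvature $-1$, $\Delta_{\mathbb{H}^N}$ is its Laplace–Beltrami operator, and $H^1(\mathbb{H}^N)$ is the usual Sobolev space of $L^2$ functions with $L^2$ gradient. Positive means $u>0$ and $v>0$ everywhere. Radial means that $u$ and $v$ depend only on the hyperbolic distance $r$ to a common fixed point; in the ball model centered at that point, $|\xi|=\tanh\frac r2$. In the variable $r$ the system for a positive radial solution reads $u''+\frac{N-1}{\tanh r}u'+v^p=0$, $v''+\frac{N-1}{\tanh r}v'+u^q=0$ for $r>0$, with $u'(0)=v'(0)=0$.
   Formalization: The formal theorem also assumes p ≥ 1 and q ≥ 1; without a lower bound the claim fails (e.g. N=3, p=0.8, q=2 has a positive radial H¹ solution with log u²/r → -3.2 instead of -4). *)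

theory Defs
  imports "HOL-Analysis.Analysis"
begin

text \<open>
  The hyperbolic space \<open>H\<^sup>N\<close> of constant curvature \<open>-1\<close> is the unit ball \<^term>\<open>ball 0 1\<close> of a
  Euclidean space \<open>'a\<close> with \<open>N = DIM('a)\<close>, carrying the Riemannian metric
  \<open>g\<^sub>x(a, b) = \<rho>(x)\<^sup>2 (a \<bullet> b)\<close>, where \<open>\<rho>(x) = 2 / (1 - |x|\<^sup>2)\<close> (Poincare ball model).
  Functions and vector fields on \<open>H\<^sup>N\<close> are total functions on \<open>'a\<close>; only their values on the
  ball matter.
\<close>

definition hyp_factor :: "'a::euclidean_space \<Rightarrow> real" where
  "hyp_factor x = 2 / (1 - (norm x)\<^sup>2)"

definition hyp_inner :: "'a::euclidean_space \<Rightarrow> 'a \<Rightarrow> 'a \<Rightarrow> real" where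
  "hyp_inner x a b = (hyp_factor x)\<^sup>2 * (a \<bullet> b)"

definition hyp_dist :: "'a::euclidean_space \<Rightarrow> 'a \<Rightarrow> real" where
  "hyp_dist x y =
     arcosh (1 + 2 * (norm (x - y))\<^sup>2 / ((1 - (norm x)\<^sup>2) * (1 - (norm y)\<^sup>2)))"

lemma norm_eq_tanh_half_hyp_dist:
  fixes x :: "'a::euclidean_space"
  assumes "x \<in> ball 0 1"
  shows "norm x = tanh (hyp_dist 0 x / 2)"
proof -
  define s where "s = norm x"
  have s: "0 \<le> s" "s < 1" using assms by (auto simp: s_def)
  define t where "t = ln (sqrt ((1 + s) / (1 - s)))"
  have pos: "(1 + s) / (1 - s) > 0" using s by simp
  have "tanh t = ((1 + s) / (1 - s) - 1) / ((1 + s) / (1 - s) + 1)"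
    unfolding t_def using pos by (subst tanh_ln_real) auto
  also have "\<dots> = s" using s by (simp add: divide_simps)
  finally have t: "tanh t = s" .
  have t0: "0 \<le> t"
    using t s(1) by (metis tanh_real_nonneg_iff)
  have s2: "1 - s\<^sup>2 > 0" using s by (simp add: abs_square_less_1)
  have "s * cosh t = sinh t" using t by (auto simp: tanh_def field_simps)
  then have "s\<^sup>2 * (cosh t)\<^sup>2 = (cosh t)\<^sup>2 - 1"
    by (metis power_mult_distrib sinh_square_eq)
  then have c: "(cosh t)\<^sup>2 = 1 / (1 - s\<^sup>2)" using s2 by (simp add: field_simps)
  have "cosh (2 * t) = 2 * (cosh t)\<^sup>2 - 1"
    by (simp add: cosh_double sinh_square_eq)
  also have "\<dots> = 1 + 2 * s\<^sup>2 / (1 - s\<^sup>2)" using s2 by (simp add: c field_simps)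
  finally have "hyp_dist 0 x = arcosh (cosh (2 * t))"
    by (simp add: hyp_dist_def s_def)
  also have "\<dots> = 2 * t" using t0 by (simp add: arcosh_cosh_real)
  finally show ?thesis using t by (simp add: s_def)
qed

text \<open>The Riemannian volume has density \<open>\<rho>\<^sup>N\<close> with respect to Lebesgue measure on the ball.\<close>

definition hyp_measure :: "'a::euclidean_space measure" where
  "hyp_measure =
     density (restrict_space lborel (ball 0 1)) (\<lambda>x. ennreal (hyp_factor x ^ DIM('a)))"

definition partial :: "'a::euclidean_space \<Rightarrow> ('a \<Rightarrow> real) \<Rightarrow> 'a \<Rightarrow> real" where
  "partial b f x = frechet_derivative f (at x) b"

text \<open>\<open>C\<^sup>k\<close> regularity; intended for open sets \<open>S\<close>.\<close>

primrec Ck_on :: "nat \<Rightarrow> ('a::euclidean_space \<Rightarrow> real) \<Rightarrow> 'a set \<Rightarrow> bool" where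
  "Ck_on 0 f S \<longleftrightarrow> continuous_on S f"
| "Ck_on (Suc k) f S \<longleftrightarrow> f differentiable_on S \<and> (\<forall>b\<in>Basis. Ck_on k (partial b f) S)"

text \<open>
  The coordinate formulas \<open>(grad u)\<^sup>i = g\<^sup>i\<^sup>j \<partial>\<^sub>j u\<close> and
  \<open>div X = |g|\<^sup>-\<^sup>1\<^sup>/\<^sup>2 \<partial>\<^sub>i (|g|\<^sup>1\<^sup>/\<^sup>2 X\<^sup>i)\<close> for the metric above, where \<open>|g|\<^sup>1\<^sup>/\<^sup>2 = \<rho>\<^sup>N\<close>.
\<close>

definition hyp_grad :: "('a::euclidean_space \<Rightarrow> real) \<Rightarrow> 'a \<Rightarrow> 'a" where
  "hyp_grad u x = (\<Sum>b\<in>Basis. (partial b u x / (hyp_factor x)\<^sup>2) *\<^sub>R b)"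

definition hyp_div :: "('a::euclidean_space \<Rightarrow> 'a) \<Rightarrow> 'a \<Rightarrow> real" where
  "hyp_div X x =
     (\<Sum>b\<in>Basis. partial b (\<lambda>y. hyp_factor y ^ DIM('a) * (X y \<bullet> b)) x) / hyp_factor x ^ DIM('a)"

definition hyp_laplacian :: "('a::euclidean_space \<Rightarrow> real) \<Rightarrow> 'a \<Rightarrow> real" where
  "hyp_laplacian u = hyp_div (hyp_grad u)"

definition test_field :: "('a::euclidean_space \<Rightarrow> 'a) \<Rightarrow> bool" where
  "test_field Z \<longleftrightarrow>
     (\<forall>k. \<forall>b\<in>Basis. Ck_on k (\<lambda>x. Z x \<bullet> b) (ball 0 1)) \<and>
     (\<exists>K. compact K \<and> K \<subseteq> ball 0 1 \<and> (\<forall>x\<in>ball 0 1 - K. Z x = 0))"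

definition hyp_weak_grad :: "('a::euclidean_space \<Rightarrow> real) \<Rightarrow> ('a \<Rightarrow> 'a) \<Rightarrow> bool" where
  "hyp_weak_grad u X \<longleftrightarrow>
     (\<forall>Z. test_field Z \<longrightarrow>
        (\<integral>x. hyp_inner x (X x) (Z x) \<partial>hyp_measure) = - (\<integral>x. u x * hyp_div Z x \<partial>hyp_measure))"

definition hyp_H1 :: "('a::euclidean_space \<Rightarrow> real) set" where
  "hyp_H1 = {u. u \<in> borel_measurable hyp_measure \<and>
      integrable hyp_measure (\<lambda>x. (u x)\<^sup>2) \<and>
      (\<exists>X \<in> borel_measurable hyp_measure.
         integrable hyp_measure (\<lambda>x. hyp_inner x (X x) (X x)) \<and> hyp_weak_grad u X)}"

text \<open>
  \<open>U\<close> is the profile \<open>u = U(r)\<close> of a function that is radial about the origin of the ball. Since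
  \<open>H\<^sup>N\<close> is homogeneous, the centre of symmetry may be placed there. Values of \<open>U\<close> at negative
  arguments are irrelevant.
\<close>

definition radial_profile :: "('a::euclidean_space \<Rightarrow> real) \<Rightarrow> (real \<Rightarrow> real) \<Rightarrow> bool" where
  "radial_profile u U \<longleftrightarrow> (\<forall>x\<in>ball 0 1. u x = U (hyp_dist 0 x))"

definition hyp_system_solution ::
    "real \<Rightarrow> real \<Rightarrow> ('a::euclidean_space \<Rightarrow> real) \<Rightarrow> ('a \<Rightarrow> real) \<Rightarrow> bool" where
  "hyp_system_solution p q u v \<longleftrightarrow>
     Ck_on 2 u (ball 0 1) \<and> Ck_on 2 v (ball 0 1) \<and>
     (\<forall>x\<in>ball 0 1.
        - hyp_laplacian u x = \<bar>v x\<bar> powr (p - 1) * v x \<and>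
        - hyp_laplacian v x = \<bar>u x\<bar> powr (q - 1) * u x)"

end

theory Submission
  imports Defs "HOL-Real_Asymp.Real_Asymp"
begin

text \<open>
  Write \<open>n = N - 1\<close>. In geodesic polar coordinates the system says that the fluxes
  \<open>sinh\<^sup>n U'\<close> and \<open>sinh\<^sup>n V'\<close> have derivatives \<open>- sinh\<^sup>n V\<^sup>p\<close> and \<open>- sinh\<^sup>n U\<^sup>q\<close> and
  vanish at the centre (\<open>radial_poisson_of_hyp_laplacian\<close>). Hence both fluxes are negative and
  decreasing, so \<open>U\<close> and \<open>V\<close> are strictly decreasing.

  A decreasing radial function in \<open>L\<^sup>2\<close> is \<open>O(exp (- n r / 2))\<close>, because the ball of radius \<open>r\<close>
  has volume of order \<open>exp (n r)\<close> (\<open>radial_square_integrable_decay\<close>). This gives the limits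
  \<open>0\<close> and a first rate of decay. The rate then improves: if \<open>V = O(exp (- \<beta> r))\<close>, integrating
  the equation twice yields \<open>U, U' = O(exp (- \<gamma> r))\<close> for every \<open>\<gamma> \<le> p \<beta>\<close> with \<open>\<gamma> < n\<close>
  (\<open>radial_poisson_exp_decay\<close>), and likewise with the roles of the functions exchanged. For
  \<open>p q > 1\<close> repetition reaches every rate below \<open>n\<close> (\<open>coupled_exp_decay_bootstrap\<close>).
  For \<open>p = q = 1\<close> there is nothing to prove: \<open>U + V\<close> would be a positive
  eigenfunction of \<open>- \<Delta>\<close> with eigenvalue \<open>1 \<le> n\<^sup>2 / 4\<close>, and such a function decays
  more slowly than the first rate allows (\<open>radial_eigenfunction_not_fast_decaying\<close>).

  In the other direction the flux is bounded away from \<open>0\<close> for \<open>r \<ge> 1\<close>, so none of the four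
  functions decays faster than \<open>exp (- n r)\<close> (\<open>radial_poisson_lower\<close>). Taking logarithms of both
  estimates and dividing by \<open>r\<close> gives the common limit \<open>- 2 n\<close>.
\<close>

section \<open>The radial Poisson equation\<close>

text \<open>
  The radial form of \<open>- \<Delta> y = h\<close> on hyperbolic space of dimension \<open>n + 1\<close>, written as
  \<open>(sinh\<^sup>n y')' = - sinh\<^sup>n h\<close>. Keeping the flux \<open>sinh\<^sup>n y'\<close> in one piece means that
  second derivatives never appear. The vanishing of the flux at the centre excludes
  multiples of the Green function.
\<close>

definition radial_poisson :: "nat \<Rightarrow> (real \<Rightarrow> real) \<Rightarrow> (real \<Rightarrow> real) \<Rightarrow> (real \<Rightarrow> real) \<Rightarrow> bool" where
  "radial_poisson n y y' h \<longleftrightarrow>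
     (\<forall>r>0. (y has_real_derivative y' r) (at r) \<and>
            ((\<lambda>s. sinh s ^ n * y' s) has_real_derivative - (sinh r ^ n * h r)) (at r)) \<and>
     ((\<lambda>s. sinh s ^ n * y' s) \<longlongrightarrow> 0) (at_right 0)"

lemma radial_poisson_flux_less:
  assumes "radial_poisson n y y' h" "\<And>r. r > 0 \<Longrightarrow> h r > 0" "0 < a" "a < b"
  shows "sinh b ^ n * y' b < sinh a ^ n * y' a"
proof (rule DERIV_neg_imp_decreasing[OF \<open>a < b\<close>])
  fix x assume x: "a \<le> x" "x \<le> b"
  with assms have "x > 0" by simp
  then have "((\<lambda>s. sinh s ^ n * y' s) has_real_derivative - (sinh x ^ n * h x)) (at x)"
    "- (sinh x ^ n * h x) < 0"
    using assms by (auto simp: radial_poisson_def)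
  then show "\<exists>y. ((\<lambda>s. sinh s ^ n * y' s) has_real_derivative y) (at x) \<and> y < 0" by blast
qed

text \<open>
  The flux starts at \<open>0\<close> and decreases strictly when the source is positive.
\<close>

lemma radial_poisson_deriv_neg:
  assumes rp: "radial_poisson n y y' h" and h: "\<And>r. r > 0 \<Longrightarrow> h r > 0" and r: "0 < r"
  shows "y' r < 0"
proof -
  let ?F = "\<lambda>s. sinh s ^ n * y' s"
  have "eventually (\<lambda>s. ?F (r/2) \<le> ?F s) (at_right 0)"
    unfolding eventually_at_right_field
    using radial_poisson_flux_less[OF rp h, of _ "r/2"] r
    by (intro exI[of _ "r/2"]) (auto intro: less_imp_le)
  moreover have "(?F \<longlongrightarrow> 0) (at_right 0)" using rp by (simp add: radial_poisson_def)
  ultimately have "?F (r/2) \<le> 0"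
    by (intro tendsto_lowerbound[of ?F 0 "at_right 0"]) auto
  moreover have "?F r < ?F (r/2)"
    using radial_poisson_flux_less[OF rp h, of "r/2" r] r by simp
  ultimately have "?F r < 0" by simp
  then show ?thesis using r by (simp add: mult_less_0_iff)
qed

lemma radial_poisson_antimono:
  assumes rp: "radial_poisson n y y' h" and h: "\<And>r. r > 0 \<Longrightarrow> h r > 0" and "0 < a" "a \<le> b"
  shows "y b \<le> y a"
proof (rule DERIV_nonpos_imp_nonincreasing[OF \<open>a \<le> b\<close>])
  fix x assume "a \<le> x" "x \<le> b"
  with assms have "x > 0" by simp
  then show "\<exists>D. (y has_real_derivative D) (at x) \<and> D \<le> 0"
    using rp radial_poisson_deriv_neg[OF rp h] less_imp_le
    unfolding radial_poisson_def by blast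
qed

lemma sinh_le_exp: "sinh r \<le> exp r" for r :: real
  unfolding sinh_field_def using exp_gt_zero[of r] exp_gt_zero[of "-r"] by (simp del: exp_gt_zero)

lemma exp_le_4_sinh:
  assumes "1 \<le> (r::real)" shows "exp r \<le> 4 * sinh r"
proof -
  have "exp (-r) \<le> 1" "exp r \<ge> 2" using assms exp_ge_add_one_self[of r] by (auto simp del: exp_ge_add_one_self)
  then have "exp (-r) * 2 \<le> 1 * exp r" by (intro mult_mono) auto
  then show ?thesis unfolding sinh_field_def by simp
qed

lemma sinh_power_bounds:
  assumes "1 \<le> (r::real)"
  shows "exp (real n * r) \<le> 4 ^ n * sinh r ^ n" "sinh r ^ n \<le> exp (real n * r)" "0 < sinh r ^ n"
proof -
  have "exp r ^ n \<le> (4 * sinh r) ^ n" by (rule power_mono[OF exp_le_4_sinh[OF assms]]) simp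
  then show "exp (real n * r) \<le> 4 ^ n * sinh r ^ n"
    by (simp add: exp_of_nat_mult power_mult_distrib)
  have "sinh r ^ n \<le> exp r ^ n" by (rule power_mono[OF sinh_le_exp]) (use assms in simp)
  then show "sinh r ^ n \<le> exp (real n * r)" by (simp add: exp_of_nat_mult)
  show "0 < sinh r ^ n" using assms by simp
qed

text \<open>
  The flux is, up to a constant, minus the integral of \<open>sinh\<^sup>n h = O(exp ((n - \<gamma>) s))\<close>, hence
  \<open>O(exp ((n - \<gamma>) r))\<close>; dividing by \<open>sinh\<^sup>n\<close> returns the rate \<open>\<gamma>\<close> of the source, and \<open>y\<close>
  is the integral of \<open>- y'\<close> over \<open>{r..}\<close>. The restriction \<open>\<gamma> < n\<close> is essential: at
  \<open>\<gamma> = n\<close> a factor \<open>r\<close> can appear, and beyond it the homogeneous solution \<open>exp (- n r)\<close>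
  dominates. Both integrations are carried out as monotonicity arguments.
\<close>

lemma radial_poisson_exp_decay:
  assumes rp: "radial_poisson n y y' h"
    and h: "\<And>r. r \<ge> 1 \<Longrightarrow> h r \<le> K * exp (- \<gamma> * r)"
    and \<gamma>: "0 < \<gamma>" "\<gamma> < real n" and K: "K \<ge> 0"
    and lim: "(y \<longlongrightarrow> 0) at_top"
  shows "\<exists>C. \<forall>r\<ge>1. - y' r \<le> C * exp (- \<gamma> * r) \<and> y r \<le> C * exp (- \<gamma> * r)"
proof -
  define \<delta> where "\<delta> = real n - \<gamma>"
  have \<delta>: "\<delta> > 0" using \<gamma> by (simp add: \<delta>_def)
  define F where "F = (\<lambda>s. sinh s ^ n * y' s)"
  define L where "L = \<bar>F 1\<bar> + K / \<delta>"
  have L0: "L \<ge> 0" using K \<delta> by (simp add: L_def)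
  define D where "D = 4 ^ n * L"
  have D0: "D \<ge> 0" using L0 by (simp add: D_def)
  have F: "- F r \<le> L * exp (\<delta> * r)" if r: "r \<ge> 1" for r
  proof -
    \<comment> \<open>The added term is a primitive of the bound for the source, so the sum is nondecreasing.\<close>
    have "F 1 + K / \<delta> * exp (\<delta> * 1) \<le> F r + K / \<delta> * exp (\<delta> * r)"
    proof (rule DERIV_nonneg_imp_nondecreasing[OF r])
      fix x :: real assume x: "1 \<le> x" "x \<le> r"
      have "(F has_real_derivative - (sinh x ^ n * h x)) (at x)"
        using rp x by (auto simp: radial_poisson_def F_def)
      then have "((\<lambda>x. F x + K / \<delta> * exp (\<delta> * x)) has_real_derivative
          - (sinh x ^ n * h x) + K * exp (\<delta> * x)) (at x)"
        using \<delta> by (auto intro!: derivative_eq_intros)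
      moreover have "sinh x ^ n * h x \<le> K * exp (\<delta> * x)"
      proof -
        have "sinh x ^ n * h x \<le> sinh x ^ n * (K * exp (- \<gamma> * x))"
          using h x sinh_power_bounds(3)[OF x(1), of n] by (intro mult_left_mono) auto
        also have "\<dots> \<le> exp (real n * x) * (K * exp (- \<gamma> * x))"
          using sinh_power_bounds(2)[OF x(1), of n] K by (intro mult_right_mono) auto
        also have "\<dots> = K * exp (\<delta> * x)" by (simp add: \<delta>_def algebra_simps flip: exp_add)
        finally show ?thesis .
      qed
      ultimately show "\<exists>D. ((\<lambda>x. F x + K / \<delta> * exp (\<delta> * x)) has_real_derivative D) (at x) \<and> 0 \<le> D"
        by (intro exI) auto
    qed
    moreover have "K / \<delta> * exp (\<delta> * 1) \<ge> 0" using K \<delta> by simp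
    moreover have "\<bar>F 1\<bar> * 1 \<le> \<bar>F 1\<bar> * exp (\<delta> * r)" using \<delta> r by (intro mult_left_mono) auto
    ultimately show ?thesis unfolding L_def by (simp add: algebra_simps)
  qed
  have y': "- y' r \<le> D * exp (- \<gamma> * r)" if r: "r \<ge> 1" for r
  proof -
    note s = sinh_power_bounds[OF r, of n]
    have "sinh r ^ n * (- y' r) \<le> L * exp (\<delta> * r)" using F[OF r] by (simp add: F_def)
    also have "\<dots> = exp (real n * r) * (L * exp (- \<gamma> * r))"
      by (simp add: \<delta>_def algebra_simps flip: exp_add)
    also have "\<dots> \<le> (4 ^ n * sinh r ^ n) * (L * exp (- \<gamma> * r))"
      using s(1) L0 by (intro mult_right_mono) auto
    also have "\<dots> = sinh r ^ n * (D * exp (- \<gamma> * r))" by (simp add: D_def)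
    finally show ?thesis using s(3) by (subst (asm) mult_le_cancel_left_pos) auto
  qed
  have y: "y r \<le> D / \<gamma> * exp (- \<gamma> * r)" if r: "r \<ge> 1" for r
  proof -
    let ?g = "\<lambda>x. y x - D / \<gamma> * exp (- \<gamma> * x)"
    have mono: "?g r \<le> ?g s" if "r \<le> s" for s
    proof (rule DERIV_nonneg_imp_nondecreasing[OF that])
      fix x assume "r \<le> x" "x \<le> s"
      then have x: "x \<ge> 1" using r by simp
      have "(y has_real_derivative y' x) (at x)" using rp x by (auto simp: radial_poisson_def)
      then have "(?g has_real_derivative y' x + D * exp (- \<gamma> * x)) (at x)"
        using \<gamma> by (auto intro!: derivative_eq_intros)
      with y'[OF x] show "\<exists>D. (?g has_real_derivative D) (at x) \<and> 0 \<le> D" by (intro exI) auto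
    qed
    have "((\<lambda>x. exp (- \<gamma> * x)) \<longlongrightarrow> 0) at_top"
      using \<gamma> by real_asymp
    then have "(?g \<longlongrightarrow> 0 - D / \<gamma> * 0) at_top" by (intro tendsto_intros lim)
    moreover have "eventually (\<lambda>s. ?g r \<le> ?g s) at_top"
      using eventually_ge_at_top[of r] by eventually_elim (rule mono)
    ultimately have "?g r \<le> 0 - D / \<gamma> * 0"
      by (rule tendsto_lowerbound) simp
    then show ?thesis by simp
  qed
  define C where "C = max D (D / \<gamma>)"
  have "D * exp (- \<gamma> * r) \<le> C * exp (- \<gamma> * r)" "D / \<gamma> * exp (- \<gamma> * r) \<le> C * exp (- \<gamma> * r)" for r
    by (intro mult_right_mono; simp add: C_def)+
  with y y' show ?thesis by (meson order_trans)
qed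

text \<open>
  Since the flux decreases from \<open>0\<close>, it stays below the negative value that it has at \<open>1\<close>;
  so \<open>- y'\<close> is at least a multiple of \<open>sinh\<^sup>-\<^sup>n\<close>, whatever the positive source is.
\<close>

lemma radial_poisson_lower:
  assumes rp: "radial_poisson n y y' h" and h: "\<And>r. r > 0 \<Longrightarrow> h r > 0" and n: "n > 0"
    and lim: "(y \<longlongrightarrow> 0) at_top"
  shows "\<exists>c>0. \<forall>r\<ge>1. c * exp (- real n * r) \<le> - y' r \<and> c * exp (- real n * r) \<le> y r"
proof -
  define d where "d = - (sinh 1 ^ n * y' 1)"
  have d: "d > 0" using radial_poisson_deriv_neg[OF rp h, of 1] by (simp add: d_def mult_pos_neg)
  have y': "d * exp (- real n * r) \<le> - y' r" if r: "r \<ge> 1" for r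
  proof -
    note s = sinh_power_bounds[OF r, of n]
    have "d \<le> sinh r ^ n * (- y' r)"
      using radial_poisson_flux_less[OF rp h, of 1 r] r by (cases "r = 1") (auto simp: d_def)
    also have "\<dots> \<le> exp (real n * r) * (- y' r)"
      using s radial_poisson_deriv_neg[OF rp h, of r] r by (intro mult_right_mono) auto
    finally show ?thesis by (simp add: exp_minus field_simps)
  qed
  have y: "d / n * exp (- real n * r) \<le> y r" if r: "r \<ge> 1" for r
  proof -
    let ?g = "\<lambda>x. y x - d / n * exp (- real n * x)"
    have mono: "?g s \<le> ?g r" if "r \<le> s" for s
    proof (rule DERIV_nonpos_imp_nonincreasing[OF that])
      fix x assume "r \<le> x" "x \<le> s"
      then have x: "x \<ge> 1" using r by simp
      have "(y has_real_derivative y' x) (at x)" using rp x by (auto simp: radial_poisson_def)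
      then have "(?g has_real_derivative y' x + d * exp (- real n * x)) (at x)"
        using n by (auto intro!: derivative_eq_intros)
      with y'[OF x] show "\<exists>D. (?g has_real_derivative D) (at x) \<and> D \<le> 0" by (intro exI) auto
    qed
    have "((\<lambda>x. exp (- real n * x)) \<longlongrightarrow> 0) at_top"
      using n by real_asymp
    then have "(?g \<longlongrightarrow> 0 - d / n * 0) at_top" by (intro tendsto_intros lim)
    moreover have "eventually (\<lambda>s. ?g s \<le> ?g r) at_top"
      using eventually_ge_at_top[of r] by eventually_elim (rule mono)
    ultimately have "0 - d / n * 0 \<le> ?g r"
      by (rule tendsto_upperbound) simp
    then show ?thesis by simp
  qed
  define c where "c = min d (d / n)"
  have "c * exp (- real n * r) \<le> d * exp (- real n * r)"
       "c * exp (- real n * r) \<le> d / n * exp (- real n * r)" for r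
    by (intro mult_right_mono; simp add: c_def)+
  with y y' have "\<forall>r\<ge>1. c * exp (- real n * r) \<le> - y' r \<and> c * exp (- real n * r) \<le> y r"
    by (meson order_trans)
  moreover have "c > 0" using d n by (simp add: c_def)
  ultimately show ?thesis by blast
qed

text \<open>
  The upper estimates may lose an arbitrarily small \<open>\<epsilon>\<close> in the rate, and their constants may
  blow up as \<open>\<epsilon>\<close> tends to \<open>0\<close>: for fixed \<open>\<epsilon>\<close> the division by \<open>r\<close> removes the constant in the
  limit, and only then does \<open>\<epsilon>\<close> have to be small.
\<close>

lemma ln_square_over_id_tendsto:
  fixes f :: "real \<Rightarrow> real"
  assumes c: "c > 0" and lower: "\<And>r. r \<ge> 1 \<Longrightarrow> c * exp (- \<nu> * r) \<le> \<bar>f r\<bar>"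
    and upper: "\<And>\<epsilon>. 0 < \<epsilon> \<Longrightarrow> \<epsilon> < \<nu> \<Longrightarrow> \<exists>C. \<forall>r\<ge>1. \<bar>f r\<bar> \<le> C * exp (- (\<nu> - \<epsilon>) * r)"
    and \<nu>: "\<nu> > 0"
  shows "((\<lambda>r. ln ((f r)\<^sup>2) / r) \<longlongrightarrow> - 2 * \<nu>) at_top"
proof -
  have fpos: "0 < \<bar>f r\<bar>" if "r \<ge> 1" for r
    using lower[OF that] c by (meson exp_gt_zero less_le_trans mult_pos_pos)
  have ln2: "ln ((f r)\<^sup>2) = 2 * ln \<bar>f r\<bar>" for r
    using ln_realpow[of "\<bar>f r\<bar>" 2] by simp
  show ?thesis
  proof (rule order_tendstoI)
    fix a assume a: "a < - 2 * \<nu>"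
    have "((\<lambda>r. 2 * ln c / r - 2 * \<nu>) \<longlongrightarrow> - 2 * \<nu>) at_top" by real_asymp
    from order_tendstoD(1)[OF this a] eventually_ge_at_top[of 1]
    show "eventually (\<lambda>r. a < ln ((f r)\<^sup>2) / r) at_top"
    proof eventually_elim
      case (elim r)
      have "ln c - \<nu> * r = ln (c * exp (- \<nu> * r))" using c by (simp add: ln_mult)
      also have "\<dots> \<le> ln \<bar>f r\<bar>" using lower[of r] elim c fpos[of r] by (subst ln_le_cancel_iff) auto
      finally have "2 * (ln c - \<nu> * r) / r \<le> 2 * ln \<bar>f r\<bar> / r"
        using elim by (intro divide_right_mono) auto
      also have "2 * (ln c - \<nu> * r) / r = 2 * ln c / r - 2 * \<nu>"
        using elim by (simp add: field_simps)
      finally have "2 * ln c / r - 2 * \<nu> \<le> ln ((f r)\<^sup>2) / r"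
        using elim by (simp add: ln2)
      then show ?case using elim by linarith
    qed
  next
    fix a assume a: "- 2 * \<nu> < a"
    define \<epsilon> where "\<epsilon> = min (\<nu> / 2) ((a + 2 * \<nu>) / 4)"
    have \<epsilon>: "0 < \<epsilon>" "\<epsilon> < \<nu>" "- 2 * (\<nu> - \<epsilon>) < a" using a \<nu> by (auto simp: \<epsilon>_def min_def field_simps)
    obtain C where C: "\<And>r. r \<ge> 1 \<Longrightarrow> \<bar>f r\<bar> \<le> C * exp (- (\<nu> - \<epsilon>) * r)"
      using upper[OF \<epsilon>(1,2)] by blast
    have "0 < C * exp (- (\<nu> - \<epsilon>) * 1)" using fpos[of 1] C[of 1] by linarith
    then have C0: "C > 0" by (simp add: zero_less_mult_iff)
    have "((\<lambda>r. 2 * ln C / r - 2 * (\<nu> - \<epsilon>)) \<longlongrightarrow> - 2 * (\<nu> - \<epsilon>)) at_top" by real_asymp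
    from order_tendstoD(2)[OF this \<epsilon>(3)] eventually_ge_at_top[of 1]
    show "eventually (\<lambda>r. ln ((f r)\<^sup>2) / r < a) at_top"
    proof eventually_elim
      case (elim r)
      have "ln \<bar>f r\<bar> \<le> ln (C * exp (- (\<nu> - \<epsilon>) * r))"
        using C[of r] elim C0 fpos[of r] by (subst ln_le_cancel_iff) auto
      also have "\<dots> = ln C - (\<nu> - \<epsilon>) * r" using C0 by (simp add: ln_mult algebra_simps)
      finally have "2 * ln \<bar>f r\<bar> / r \<le> 2 * (ln C - (\<nu> - \<epsilon>) * r) / r"
        using elim by (intro divide_right_mono) auto
      also have "2 * (ln C - (\<nu> - \<epsilon>) * r) / r = 2 * ln C / r - 2 * (\<nu> - \<epsilon>)"
        using elim by (simp add: field_simps)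
      finally have "ln ((f r)\<^sup>2) / r \<le> 2 * ln C / r - 2 * (\<nu> - \<epsilon>)"
        using elim by (simp add: ln2)
      then show ?case using elim by linarith
    qed
  qed
qed

section \<open>Decay rates of coupled radial equations\<close>

lemma radial_poisson_powr_exp_decay:
  assumes rp: "radial_poisson n y y' (\<lambda>r. z r powr p)"
    and z: "\<And>r. r \<ge> 1 \<Longrightarrow> 0 < z r"
    and bound: "\<exists>C. \<forall>r\<ge>1. z r \<le> C * exp (- \<beta> * r)"
    and p: "p \<ge> 1" and \<gamma>: "0 < \<gamma>" "\<gamma> < real n" "\<gamma> \<le> p * \<beta>"
    and lim: "(y \<longlongrightarrow> 0) at_top"
  shows "\<exists>C. \<forall>r\<ge>1. - y' r \<le> C * exp (- \<gamma> * r) \<and> y r \<le> C * exp (- \<gamma> * r)"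
proof -
  obtain C where C: "\<And>r. r \<ge> 1 \<Longrightarrow> z r \<le> C * exp (- \<beta> * r)" using bound by blast
  have "0 < C * exp (- \<beta> * 1)" using z[of 1] C[of 1] by linarith
  then have C0: "C > 0" by (simp add: zero_less_mult_iff)
  have "z r powr p \<le> C powr p * exp (- \<gamma> * r)" if r: "r \<ge> 1" for r
  proof -
    have "z r powr p \<le> (C * exp (- \<beta> * r)) powr p"
      using z[OF r] C[OF r] p by (intro powr_mono2) auto
    also have "\<dots> = C powr p * exp (- (p * \<beta>) * r)"
      using C0 by (simp add: powr_mult exp_powr_real algebra_simps)
    also have "\<dots> \<le> C powr p * exp (- \<gamma> * r)"
      using \<gamma>(3) r by (intro mult_left_mono) auto
    finally show ?thesis .
  qed
  from radial_poisson_exp_decay[OF rp this \<gamma>(1,2) _ lim] show ?thesis by simp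
qed

text \<open>
  Passing once around the system multiplies the rate of decay by \<open>p q > 1\<close>, until it is cut off
  at \<open>\<gamma>\<close>. So any positive initial rate \<open>\<alpha>\<close> reaches every \<open>\<gamma> < n\<close> in finitely many rounds.
\<close>

lemma coupled_exp_decay_bootstrap:
  assumes rpy: "radial_poisson n y y' (\<lambda>r. z r powr p)"
    and rpz: "radial_poisson n z z' (\<lambda>r. y r powr q)"
    and pos: "\<And>r. r > 0 \<Longrightarrow> 0 < y r" "\<And>r. r > 0 \<Longrightarrow> 0 < z r"
    and pq: "1 \<le> p" "1 \<le> q" "1 < p * q"
    and lim: "(y \<longlongrightarrow> 0) at_top" "(z \<longlongrightarrow> 0) at_top"
    and \<alpha>: "0 < \<alpha>" and initial: "\<exists>C. \<forall>r\<ge>1. z r \<le> C * exp (- \<alpha> * r)"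
    and \<gamma>: "0 < \<gamma>" "\<gamma> < real n"
  shows "\<exists>C. \<forall>r\<ge>1. - y' r \<le> C * exp (- \<gamma> * r) \<and> y r \<le> C * exp (- \<gamma> * r)"
    and "\<exists>C. \<forall>r\<ge>1. - z' r \<le> C * exp (- \<gamma> * r) \<and> z r \<le> C * exp (- \<gamma> * r)"
proof -
  define \<beta> where "\<beta> k = min \<gamma> (\<alpha> * (p * q) ^ k)" for k
  have \<beta>0: "0 < \<beta> k" "\<beta> k \<le> \<gamma>" for k
    using \<alpha> pq \<gamma> by (auto simp: \<beta>_def)
  have step_y: "\<exists>C. \<forall>r\<ge>1. - y' r \<le> C * exp (- min \<gamma> (p * b) * r) \<and> y r \<le> C * exp (- min \<gamma> (p * b) * r)"
    if "\<exists>C. \<forall>r\<ge>1. z r \<le> C * exp (- b * r)" "0 < b" for b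
    using that pq \<gamma> pos lim
    by (intro radial_poisson_powr_exp_decay[OF rpy]) auto
  have step_z: "\<exists>C. \<forall>r\<ge>1. - z' r \<le> C * exp (- min \<gamma> (q * b) * r) \<and> z r \<le> C * exp (- min \<gamma> (q * b) * r)"
    if "\<exists>C. \<forall>r\<ge>1. y r \<le> C * exp (- b * r)" "0 < b" for b
    using that pq \<gamma> pos lim
    by (intro radial_poisson_powr_exp_decay[OF rpz]) auto
  have iter: "\<exists>C. \<forall>r\<ge>1. z r \<le> C * exp (- \<beta> k * r)" for k
  proof (induction k)
    case 0
    obtain C where C: "\<And>r. r \<ge> 1 \<Longrightarrow> z r \<le> C * exp (- \<alpha> * r)" using initial by blast
    have "z r \<le> \<bar>C\<bar> * exp (- \<beta> 0 * r)" if "r \<ge> 1" for r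
    proof -
      have "z r \<le> C * exp (- \<alpha> * r)" by (rule C[OF that])
      also have "\<dots> \<le> \<bar>C\<bar> * exp (- \<beta> 0 * r)"
        using that by (intro mult_mono) (auto simp: \<beta>_def)
      finally show ?thesis .
    qed
    then show ?case by blast
  next
    case (Suc k)
    have "\<exists>C. \<forall>r\<ge>1. y r \<le> C * exp (- min \<gamma> (p * \<beta> k) * r)"
      using step_y[OF Suc \<beta>0(1)] by blast
    from step_z[OF this] have *: "\<exists>C. \<forall>r\<ge>1. z r \<le> C * exp (- min \<gamma> (q * min \<gamma> (p * \<beta> k)) * r)"
      using \<gamma> pq \<beta>0(1)[of k] by auto
    have "min \<gamma> (q * min \<gamma> (p * \<beta> k)) = \<beta> (Suc k)"
    proof -
      have "q * \<gamma> \<ge> \<gamma>" "q * (p * \<gamma>) \<ge> \<gamma>"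
        using pq \<gamma> mult_mono[of 1 "p * q" \<gamma> \<gamma>] by (auto simp: ac_simps)
      then show ?thesis
        using pq by (simp add: \<beta>_def min_mult_distrib_left ac_simps)
    qed
    with * show ?case by simp
  qed
  obtain k where k: "\<gamma> / \<alpha> < (p * q) ^ k" using real_arch_pow[OF pq(3)] by blast
  then have "\<beta> k = \<gamma>" using \<alpha> by (simp add: \<beta>_def field_simps)
  with iter have z: "\<exists>C. \<forall>r\<ge>1. z r \<le> C * exp (- \<gamma> * r)" by metis
  have "min \<gamma> (p * \<gamma>) = \<gamma>" "min \<gamma> (q * \<gamma>) = \<gamma>" using pq \<gamma> by (auto simp: min_def)
  with step_y[OF z \<gamma>(1)] show y: "\<exists>C. \<forall>r\<ge>1. - y' r \<le> C * exp (- \<gamma> * r) \<and> y r \<le> C * exp (- \<gamma> * r)"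
    by simp
  then have "\<exists>C. \<forall>r\<ge>1. y r \<le> C * exp (- \<gamma> * r)" by blast
  from step_z[OF this \<gamma>(1)] \<open>min \<gamma> (q * \<gamma>) = \<gamma>\<close>
  show "\<exists>C. \<forall>r\<ge>1. - z' r \<le> C * exp (- \<gamma> * r) \<and> z r \<le> C * exp (- \<gamma> * r)" by simp
qed

text \<open>
  The case \<open>p = q = 1\<close>, where iteration gains nothing. With \<open>a = n / 2\<close> the substitution
  \<open>\<phi> = sinh\<^sup>a z\<close> removes the first order term from \<open>z'' + n coth(r) z' + z = 0\<close> and gives
  \<open>\<phi>'' = (a - 1 + a (a - 1) coth\<^sup>2) \<phi>\<close>, so \<open>\<phi>\<close> is convex for \<open>a \<ge> 1\<close>. Being positive and
  vanishing at \<open>0\<close>, it grows at least linearly, whereas a decay of \<open>z\<close> like \<open>exp (- a r)\<close>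
  would keep it bounded. The constant \<open>n\<^sup>2 / 4\<close> is the bottom of the \<open>L\<^sup>2\<close>
  spectrum of \<open>- \<Delta>\<close>; the eigenvalue \<open>1\<close> lies below it for \<open>n > 2\<close> and equals it for
  \<open>n = 2\<close>, where it is the borderline \<open>z = r / sinh r\<close> that has to be excluded.
\<close>

lemma radial_eigenfunction_not_fast_decaying:
  assumes rp: "radial_poisson n z z' z" and pos: "\<And>r. r > 0 \<Longrightarrow> 0 < z r"
    and n: "n \<ge> 2" and bounded: "\<And>r. r > 0 \<Longrightarrow> z r \<le> M"
    and decay: "\<forall>r\<ge>1. z r \<le> C * exp (- (real n / 2) * r)"
  shows False
proof -
  define a where "a = real n / 2"
  have a: "a \<ge> 1" using n by (simp add: a_def)
  define F where "F = (\<lambda>s. sinh s ^ n * z' s)"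
  define \<phi> where "\<phi> = (\<lambda>r. sinh r powr a * z r)"
  define \<phi>' where "\<phi>' = (\<lambda>r. sinh r powr (-a) * F r + a * sinh r powr (a-1) * cosh r * z r)"
  define \<phi>'' where "\<phi>'' = (\<lambda>r. ((a - 1) * sinh r powr a + a * (a-1) * sinh r powr (a-2) * (cosh r)\<^sup>2) * z r)"
  have z': "(z has_real_derivative z' r) (at r)" if "r > 0" for r
    using rp that by (auto simp: radial_poisson_def)
  have powr': "((\<lambda>x. sinh x powr b) has_real_derivative b * sinh r powr (b-1) * cosh r) (at r)"
    if "r > 0" for b r :: real
    using that by (intro DERIV_chain2[OF has_real_derivative_powr]) (auto intro!: derivative_eq_intros)
  have Fpowr: "F r = sinh r powr (2 * a) * z' r" if "r > 0" for r
    using that by (simp add: F_def a_def powr_realpow)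
  have D1: "(\<phi> has_real_derivative \<phi>' r) (at r)" if r: "r > 0" for r
  proof -
    have "(\<phi> has_real_derivative sinh r powr a * z' r + a * sinh r powr (a-1) * cosh r * z r) (at r)"
      unfolding \<phi>_def using r
      by (auto intro!: derivative_eq_intros powr' z')
    also have "sinh r powr a * z' r = sinh r powr (-a) * F r"
      using r by (simp add: Fpowr flip: powr_add mult.assoc)
    finally show ?thesis by (simp add: \<phi>'_def)
  qed
  have D2: "(\<phi>' has_real_derivative \<phi>'' r) (at r)" if r: "r > 0" for r
  proof -
    have FD: "(F has_real_derivative - (sinh r powr (2 * a) * z r)) (at r)"
      using rp r by (simp add: radial_poisson_def F_def a_def powr_realpow)
    define S where "S = sinh r" 
    have S: "S > 0" using r by (simp add: S_def)
    have "(\<phi>' has_real_derivative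
       (- a * (S powr (-a-1) * cosh r * F r) + S powr (-a) * (- (S powr (2 * a) * z r))) +
       a * ((a-1) * S powr (a-2) * cosh r * cosh r * z r + S powr (a-1) * S * z r
          + S powr (a-1) * cosh r * z' r)) (at r)"
      unfolding \<phi>'_def using r
      by (auto intro!: derivative_eq_intros powr' FD z' simp: S_def algebra_simps)
    also have "S powr (-a-1) * cosh r * F r = S powr (a-1) * cosh r * z' r"
    proof -
      have "S powr (-a-1) * S powr (2*a) = S powr (a-1)" by (simp flip: powr_add)
      then show ?thesis using r by (simp add: Fpowr S_def ac_simps)
    qed
    also have "S powr (a-1) * S = S powr a" using S by (simp add: powr_diff)
    also have "S powr (-a) * (- (S powr (2 * a) * z r)) = - (S powr a * z r)"
      by (simp flip: powr_add mult.assoc)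
    finally show ?thesis by (simp add: \<phi>''_def S_def algebra_simps power2_eq_square)
  qed
  have "\<phi>'' r \<ge> 0" if "r > 0" for r using a pos[OF that] by (simp add: \<phi>''_def)
  then have \<phi>'_mono: "\<phi>' r \<le> \<phi>' s" if "0 < r" "r \<le> s" for r s
    using that D2 by (intro DERIV_nonneg_imp_nondecreasing[OF that(2)]) (metis order.strict_trans2)
  \<comment> \<open>Otherwise \<open>\<phi>\<close> would be nonincreasing, against \<open>\<phi> > 0\<close> and \<open>\<phi> \<longlongrightarrow> 0\<close> at the centre.\<close>
  obtain r0 where r0: "r0 > 0" "\<phi>' r0 > 0"
  proof (rule ccontr)
    assume "\<not> thesis"
    with that have neg: "\<phi>' r \<le> 0" if "r > 0" for r using that by force
    have "\<phi> 1 \<le> \<phi> s" if "0 < s" "s \<le> 1" for s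
      using neg D1 that by (intro DERIV_nonpos_imp_nonincreasing[OF that(2)]) (metis order.strict_trans2)
    moreover have "\<phi> s \<le> sinh s powr a * M" if "0 < s" for s
      using bounded[OF that] by (simp add: \<phi>_def mult_left_mono)
    ultimately have "\<phi> 1 \<le> sinh s powr a * M" if "0 < s" "s \<le> 1" for s
      using that order_trans by blast
    then have "eventually (\<lambda>s. \<phi> 1 \<le> sinh s powr a * M) (at_right 0)"
      unfolding eventually_at_right_field by (intro exI[of _ 1]) auto
    moreover have "((\<lambda>s. sinh s powr a * M) \<longlongrightarrow> 0 * M) (at_right 0)"
      using a by (intro tendsto_intros) real_asymp
    ultimately have "\<phi> 1 \<le> 0 * M"
      by (intro tendsto_lowerbound[of _ _ "at_right (0::real)"]) auto
    with pos[of 1] show False by (simp add: \<phi>_def mult_le_0_iff)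
  qed
  define K where "K = \<bar>C\<bar>"
  have bnd: "\<phi> r \<le> K" if r: "r \<ge> 1" for r
  proof -
    have "\<phi> r \<le> exp r powr a * (K * exp (- (real n / 2) * r))"
      unfolding \<phi>_def
    proof (rule mult_mono)
      show "sinh r powr a \<le> exp r powr a" using sinh_le_exp[of r] r a by (intro powr_mono2) auto
      have "C * exp (- (real n / 2) * r) \<le> K * exp (- (real n / 2) * r)"
        by (intro mult_right_mono) (auto simp: K_def)
      then show "z r \<le> K * exp (- (real n / 2) * r)" using decay r order_trans by blast
    qed (use pos[of r] r in auto)
    also have "\<dots> = K" by (simp add: exp_powr_real a_def flip: exp_add)
    finally show ?thesis .
  qed
  define R where "R = max r0 1"
  \<comment> \<open>At \<open>s\<close> the line of slope \<open>\<phi>'(r0)\<close> through \<open>(R, 0)\<close> has passed the bound \<open>K\<close> by \<open>1\<close>.\<close>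
  define s where "s = R + (K + 1) / \<phi>' r0"
  have s: "R \<le> s" using r0 by (simp add: s_def K_def)
  have "\<phi> R - \<phi>' r0 * R \<le> \<phi> s - \<phi>' r0 * s"
  proof (rule DERIV_nonneg_imp_nondecreasing[OF s])
    fix x assume "R \<le> x" "x \<le> s"
    then have x: "r0 \<le> x" "0 < x" using r0 by (auto simp: R_def)
    have "((\<lambda>r. \<phi> r - \<phi>' r0 * r) has_real_derivative \<phi>' x - \<phi>' r0) (at x)"
      using D1[OF x(2)] by (auto intro!: derivative_eq_intros)
    then show "\<exists>D. ((\<lambda>r. \<phi> r - \<phi>' r0 * r) has_real_derivative D) (at x) \<and> 0 \<le> D"
      using \<phi>'_mono[OF r0(1) x(1)] by (intro exI) auto
  qed
  moreover have "\<phi>' r0 * s = \<phi>' r0 * R + (K + 1)" using r0 by (simp add: s_def field_simps)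
  moreover have "0 < R" using r0 by (auto simp: R_def)
  then have "0 \<le> \<phi> R" using pos[of R] by (simp add: \<phi>_def)
  moreover have "\<phi> s \<le> K" using s by (intro bnd) (simp add: R_def)
  ultimately show False by linarith
qed

text \<open>
  For \<open>p q > 1\<close> this is the bootstrap. Otherwise \<open>p = q = 1\<close>, and \<open>y + z\<close> would be an
  eigenfunction of the kind just excluded.
\<close>

lemma coupled_exp_decay:
  assumes rpy: "radial_poisson n y y' (\<lambda>r. z r powr p)"
    and rpz: "radial_poisson n z z' (\<lambda>r. y r powr q)"
    and pos: "\<And>r. r > 0 \<Longrightarrow> 0 < y r" "\<And>r. r > 0 \<Longrightarrow> 0 < z r"
    and pq: "1 \<le> p" "1 \<le> q" and n: "n \<ge> 2"
    and bounded: "\<And>r. r > 0 \<Longrightarrow> y r \<le> M" "\<And>r. r > 0 \<Longrightarrow> z r \<le> M"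
    and decay: "\<exists>C. \<forall>r\<ge>1. y r \<le> C * exp (- (real n / 2) * r)"
        "\<exists>C. \<forall>r\<ge>1. z r \<le> C * exp (- (real n / 2) * r)"
    and lim: "(y \<longlongrightarrow> 0) at_top" "(z \<longlongrightarrow> 0) at_top"
    and \<gamma>: "0 < \<gamma>" "\<gamma> < real n"
  shows "\<exists>C. \<forall>r\<ge>1. - y' r \<le> C * exp (- \<gamma> * r) \<and> y r \<le> C * exp (- \<gamma> * r)"
proof (cases "p * q > 1")
  case True
  show ?thesis
    by (rule coupled_exp_decay_bootstrap(1)[OF rpy rpz pos pq True lim _ decay(2) \<gamma>]) (use n in auto)
next
  case False
  have "p = 1" "q = 1"
    using False pq mult_left_mono[of 1 q p] mult_right_mono[of 1 p q] by linarith+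
  have eq: "r > 0 \<Longrightarrow> z r powr p = z r" "r > 0 \<Longrightarrow> y r powr q = y r" for r
    using pos[of r] \<open>p = 1\<close> \<open>q = 1\<close> by auto
  obtain C D where C: "\<And>r. r\<ge>1 \<Longrightarrow> y r \<le> C * exp (- (real n / 2) * r)"
    and D: "\<And>r. r\<ge>1 \<Longrightarrow> z r \<le> D * exp (- (real n / 2) * r)" using decay by blast
  let ?w = "\<lambda>r. y r + z r" and ?w' = "\<lambda>r. y' r + z' r"
  have "radial_poisson n ?w ?w' ?w"
    unfolding radial_poisson_def
  proof (intro conjI allI impI)
    fix r :: real assume r: "0 < r"
    then show "(?w has_real_derivative ?w' r) (at r)"
      using rpy rpz by (auto simp: radial_poisson_def intro!: derivative_eq_intros)
    have "((\<lambda>s. sinh s ^ n * y' s + sinh s ^ n * z' s) has_real_derivative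
        - (sinh r ^ n * z r) + - (sinh r ^ n * y r)) (at r)"
      using rpy rpz r by (intro DERIV_add) (auto simp: radial_poisson_def eq)
    then show "((\<lambda>s. sinh s ^ n * ?w' s) has_real_derivative - (sinh r ^ n * ?w r)) (at r)"
      by (simp add: algebra_simps)
  next
    have "((\<lambda>s. sinh s ^ n * y' s + sinh s ^ n * z' s) \<longlongrightarrow> 0 + 0) (at_right 0)"
      using rpy rpz by (intro tendsto_add) (auto simp: radial_poisson_def)
    then show "((\<lambda>s. sinh s ^ n * ?w' s) \<longlongrightarrow> 0) (at_right 0)"
      by (simp add: algebra_simps)
  qed
  then have False
  proof (rule radial_eigenfunction_not_fast_decaying[OF _ _ n])
    show "?w r \<le> M + M" if "r > 0" for r using bounded[OF that] by simp
    show "\<forall>r\<ge>1. ?w r \<le> (C + D) * exp (- (real n / 2) * r)"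
      using C D by (simp add: distrib_right add_mono)
  qed (use pos in \<open>simp add: add_pos_pos\<close>)
  then show ?thesis ..
qed

lemma coupled_radial_asymptotics:
  assumes rpy: "radial_poisson n y y' (\<lambda>r. z r powr p)"
    and rpz: "radial_poisson n z z' (\<lambda>r. y r powr q)"
    and pos: "\<And>r. r > 0 \<Longrightarrow> 0 < y r" "\<And>r. r > 0 \<Longrightarrow> 0 < z r"
    and pq: "1 \<le> p" "1 \<le> q" and n: "n \<ge> 2"
    and bounded: "\<And>r. r > 0 \<Longrightarrow> y r \<le> M" "\<And>r. r > 0 \<Longrightarrow> z r \<le> M"
    and decay: "\<exists>C. \<forall>r\<ge>1. y r \<le> C * exp (- (real n / 2) * r)"
        "\<exists>C. \<forall>r\<ge>1. z r \<le> C * exp (- (real n / 2) * r)"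
    and lim: "(y \<longlongrightarrow> 0) at_top" "(z \<longlongrightarrow> 0) at_top"
  shows "(y' \<longlongrightarrow> 0) at_top"
    and "((\<lambda>r. ln ((y r)\<^sup>2) / r) \<longlongrightarrow> - 2 * real n) at_top"
    and "((\<lambda>r. ln ((y' r)\<^sup>2) / r) \<longlongrightarrow> - 2 * real n) at_top"
proof -
  have h: "\<And>r. r > 0 \<Longrightarrow> 0 < z r powr p" using pos(2) powr_gt_zero by (metis less_irrefl)
  note y'neg = radial_poisson_deriv_neg[OF rpy h]
  obtain c where c: "c > 0" "\<And>r. r \<ge> 1 \<Longrightarrow> c * exp (- real n * r) \<le> - y' r"
     "\<And>r. r \<ge> 1 \<Longrightarrow> c * exp (- real n * r) \<le> y r"
    using radial_poisson_lower[OF rpy h _ lim(1)] n by auto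
  have up: "\<exists>C. \<forall>r\<ge>1. - y' r \<le> C * exp (- (real n - \<epsilon>) * r) \<and> y r \<le> C * exp (- (real n - \<epsilon>) * r)"
    if "0 < \<epsilon>" "\<epsilon> < real n" for \<epsilon>
    by (rule coupled_exp_decay[OF rpy rpz pos pq n bounded decay lim]) (use that in auto)
  have absy: "\<bar>y r\<bar> = y r" "\<bar>y' r\<bar> = - y' r" if "r \<ge> 1" for r
    using pos(1)[of r] y'neg[of r] that by auto
  show "((\<lambda>r. ln ((y r)\<^sup>2) / r) \<longlongrightarrow> - 2 * real n) at_top"
    using c n up by (intro ln_square_over_id_tendsto[of c]) (fastforce simp: absy)+
  show "((\<lambda>r. ln ((y' r)\<^sup>2) / r) \<longlongrightarrow> - 2 * real n) at_top"
    using c n up by (intro ln_square_over_id_tendsto[of c]) (fastforce simp: absy)+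
  obtain C where C: "\<And>r. r \<ge> 1 \<Longrightarrow> - y' r \<le> C * exp (- (real n - 1) * r)"
    using up[of 1] n by auto
  show "(y' \<longlongrightarrow> 0) at_top"
  proof (rule tendsto_sandwich)
    show "eventually (\<lambda>r. - (C * exp (- (real n - 1) * r)) \<le> y' r) at_top"
      using eventually_ge_at_top[of 1] by eventually_elim (use C in force)
    show "eventually (\<lambda>r. y' r \<le> 0) at_top"
      using eventually_gt_at_top[of 0] by eventually_elim (use y'neg in force)
    have "real n - 1 > 0" using n by simp
    then have "((\<lambda>r. exp (- (real n - 1) * r)) \<longlongrightarrow> 0) at_top" by real_asymp
    then have "((\<lambda>r. - (C * exp (- (real n - 1) * r))) \<longlongrightarrow> - (C * 0)) at_top"
      by (intro tendsto_intros)
    then show "((\<lambda>r. - (C * exp (- (real n - 1) * r))) \<longlongrightarrow> 0) at_top" by simp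
  qed simp
qed

section \<open>From the hyperbolic Laplacian to the radial equation\<close>

lemma Ck_on_2_differentiable:
  assumes "Ck_on 2 u S" "open S" "x \<in> S"
  shows "u differentiable (at x)" and "b \<in> Basis \<Longrightarrow> partial b u differentiable (at x)"
  using assms by (auto simp: numeral_2_eq_2 differentiable_on_eq_differentiable_at)

lemma partial_has_real_derivative_line:
  assumes "u differentiable (at (s *\<^sub>R e))"
  shows "((\<lambda>s. u (s *\<^sub>R e)) has_real_derivative partial e u (s *\<^sub>R e)) (at s)"
proof -
  let ?D = "frechet_derivative u (at (s *\<^sub>R e))"
  have D: "(u has_derivative ?D) (at (s *\<^sub>R e))"
    using assms by (simp add: frechet_derivative_works)
  have "((\<lambda>s. s *\<^sub>R e) has_derivative (\<lambda>h. h *\<^sub>R e)) (at s)"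
    by (auto intro!: derivative_eq_intros)
  from has_derivative_compose[OF this, of u ?D] D
  have "((\<lambda>s. u (s *\<^sub>R e)) has_derivative (\<lambda>h. ?D (h *\<^sub>R e))) (at s)" by simp
  moreover have "?D (h *\<^sub>R e) = partial e u (s *\<^sub>R e) * h" for h
    using linear_frechet_derivative[OF assms] by (simp add: linear_cmul partial_def)
  ultimately show ?thesis by (simp add: has_field_derivative_def mult_commute_abs)
qed

text \<open>
  Off the origin the coordinate fields of the divergence are \<open>\<rho>\<^sup>N (grad u)\<^sub>b = G(|x|) x\<^sub>b\<close> with
  \<open>G(s) = \<rho>(s)\<^sup>N\<^sup>-\<^sup>2 f'(s) / s\<close>, so that
  \<open>\<rho>\<^sup>N \<Delta>u = \<Sum>\<^sub>b \<partial>\<^sub>b (G(|x|) x\<^sub>b) = t G'(t) + N G(t) = t\<^sup>1\<^sup>-\<^sup>N (t\<^sup>N G(t))'\<close> at \<open>t = |x|\<close>. The flux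
  differentiated below is \<open>t\<^sup>N G(t)\<close>, for \<open>N = n + 2\<close>.
\<close>

lemma hyp_laplacian_radial_flux:
  fixes u :: "'a::euclidean_space \<Rightarrow> real"
  assumes radial: "\<And>y. y \<in> ball 0 1 \<Longrightarrow> u y = f (norm y)"
    and f': "\<And>s. 0 < s \<Longrightarrow> s < 1 \<Longrightarrow> (f has_real_derivative f' s) (at s)"
    and f'': "(f' has_real_derivative f'') (at (norm x))"
    and x: "x \<in> ball 0 1" "x \<noteq> 0" and dim: "DIM('a) = n + 2"
  shows "((\<lambda>s. s ^ (n + 1) * (2 / (1 - s\<^sup>2)) ^ n * f' s) has_real_derivative
           norm x ^ (n + 1) * hyp_factor x ^ (n + 2) * hyp_laplacian u x) (at (norm x))"
proof -
  define B where "B = ball 0 1 - {0::'a}"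
  have B: "open B" "x \<in> B" using x by (auto simp: B_def open_Diff)
  have partial_u: "partial b u y = f' (norm y) * (y \<bullet> b) / norm y" if y: "y \<in> B" for b y
  proof -
    have "(f has_derivative (\<lambda>h. f' (norm y) * h)) (at (norm y))"
      using f'[of "norm y"] y by (simp add: B_def has_field_derivative_def)
    from has_derivative_compose[OF has_derivative_norm[of y] this] y
    have "((\<lambda>y. f (norm y)) has_derivative (\<lambda>h. f' (norm y) * (sgn y \<bullet> h))) (at y)"
      by (auto simp: B_def inner_commute)
    then have "(u has_derivative (\<lambda>h. f' (norm y) * (sgn y \<bullet> h))) (at y)"
      by (rule has_derivative_transform_within_open[OF _ B(1) y]) (auto simp: B_def radial)
    from frechet_derivative_at[OF this, symmetric] show ?thesis
      by (simp add: partial_def sgn_div_norm divide_simps)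
  qed
  define t where "t = norm x"
  have t: "0 < t" "t < 1" using x by (auto simp: t_def)
  have t2: "1 - t\<^sup>2 > 0" using t by (simp add: abs_square_less_1)
  define G where "G = (\<lambda>s. (2 / (1 - s\<^sup>2)) ^ n * f' s / s)"
  have "\<exists>G'. (G has_real_derivative G') (at t)"
    unfolding G_def using t t2 f'' t_def
    by (intro exI) (rule derivative_eq_intros refl | simp)+
  then obtain G' where G': "(G has_real_derivative G') (at t)" by blast
  have flux: "hyp_factor y ^ (n + 2) * (hyp_grad u y \<bullet> b) = G (norm y) * (y \<bullet> b)"
    if b: "b \<in> Basis" and y: "y \<in> B" for b y
  proof -
    have "(norm y)\<^sup>2 < 1" using y by (simp add: B_def abs_square_less_1)
    then have "hyp_factor y \<noteq> 0" by (simp add: hyp_factor_def)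
    moreover have "hyp_grad u y \<bullet> b = partial b u y / (hyp_factor y)\<^sup>2"
      using b by (simp add: hyp_grad_def)
    moreover have "G (norm y) = hyp_factor y ^ n * f' (norm y) / norm y"
      by (simp add: G_def hyp_factor_def)
    ultimately show ?thesis
      using partial_u[OF y, of b] by (simp add: power_add power2_eq_square)
  qed
  have "partial b (\<lambda>y. hyp_factor y ^ DIM('a) * (hyp_grad u y \<bullet> b)) x = G' / t * (x \<bullet> b)\<^sup>2 + G t"
    if b: "b \<in> Basis" for b
  proof -
    have "(G has_derivative (\<lambda>h. G' * h)) (at (norm x))"
      using G' by (simp add: has_field_derivative_def t_def)
    from has_derivative_compose[OF has_derivative_norm[OF x(2)] this]
    have "((\<lambda>y. G (norm y) * (y \<bullet> b)) has_derivative
        (\<lambda>h. G (norm x) * (h \<bullet> b) + G' * (sgn x \<bullet> h) * (x \<bullet> b))) (at x)"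
      by (auto intro!: derivative_eq_intros simp: inner_commute)
    then have "((\<lambda>y. hyp_factor y ^ DIM('a) * (hyp_grad u y \<bullet> b)) has_derivative
        (\<lambda>h. G (norm x) * (h \<bullet> b) + G' * (sgn x \<bullet> h) * (x \<bullet> b))) (at x)"
      by (rule has_derivative_transform_within_open[OF _ B]) (use flux[OF b] dim in simp)
    from frechet_derivative_at[OF this, symmetric] show ?thesis
      using b by (simp add: partial_def sgn_div_norm power2_eq_square t_def divide_simps)
  qed
  then have "hyp_laplacian u x * hyp_factor x ^ DIM('a) =
      (\<Sum>b\<in>Basis. G' / t * (x \<bullet> b)\<^sup>2 + G t)"
    using t t2 by (simp add: hyp_laplacian_def hyp_div_def hyp_factor_def t_def)
  also have "\<dots> = G' / t * (\<Sum>b\<in>Basis. (x \<bullet> b)\<^sup>2) + DIM('a) * G t"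
    by (simp add: sum.distrib sum_distrib_left)
  also have "(\<Sum>b\<in>Basis. (x \<bullet> b)\<^sup>2) = t\<^sup>2"
    unfolding t_def power2_norm_eq_inner euclidean_inner[of x x] by (simp add: power2_eq_square)
  finally have lap: "hyp_factor x ^ (n + 2) * hyp_laplacian u x = G' * t + (n + 2) * G t"
    using t dim by (simp add: power2_eq_square mult.commute)
  have "((\<lambda>s. s ^ (n + 2) * G s) has_real_derivative
     t ^ (n + 1) * (hyp_factor x ^ (n + 2) * hyp_laplacian u x)) (at t)"
  proof -
    have "((\<lambda>s. s ^ (n + 2)) has_real_derivative (n + 2) * t ^ (n + 1)) (at t)"
      using DERIV_pow[of "n + 2" t] by simp
    from DERIV_mult[OF this G'] show ?thesis
      unfolding lap by (simp add: algebra_simps)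
  qed
  then have "((\<lambda>s. s ^ (n + 1) * (2 / (1 - s\<^sup>2)) ^ n * f' s) has_real_derivative
     t ^ (n + 1) * (hyp_factor x ^ (n + 2) * hyp_laplacian u x)) (at t)"
    by (rule has_field_derivative_transform_within_open[where S = "{0<..}"])
       (use t in \<open>auto simp: G_def\<close>)
  then show ?thesis by (simp add: t_def mult.assoc)
qed

lemma hyp_dist_eq:
  fixes x :: "'a::euclidean_space"
  assumes "norm x = tanh (r / 2)"
  shows "hyp_dist 0 x = r"
proof -
  have "x \<in> ball 0 1" using assms tanh_real_lt_1[of "r/2"] by simp
  from norm_eq_tanh_half_hyp_dist[OF this] assms show ?thesis by simp
qed

lemma sinh_eq_tanh_half:
  fixes r :: real
  shows "sinh r = tanh (r / 2) * (2 / (1 - (tanh (r / 2))\<^sup>2))"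
proof -
  define c s where "c = cosh (r / 2)" and "s = sinh (r / 2)"
  have c: "c > 0" by (simp add: c_def)
  have "c\<^sup>2 - s\<^sup>2 = 1" by (simp add: c_def s_def cosh_square_eq)
  moreover have "1 - (s / c)\<^sup>2 = (c\<^sup>2 - s\<^sup>2) / c\<^sup>2" using c by (simp add: field_simps)
  ultimately have "1 - (s / c)\<^sup>2 = 1 / c\<^sup>2" by simp
  then have "s / c * (2 / (1 - (s / c)\<^sup>2)) = 2 * s * c" using c by (simp add: power2_eq_square)
  moreover have "sinh r = 2 * s * c" using sinh_double[of "r / 2"] by (simp add: c_def s_def)
  ultimately show ?thesis by (simp add: tanh_def c_def s_def)
qed

text \<open>
  Under \<open>s = tanh (r / 2)\<close> one has \<open>sinh r = s \<rho>(s)\<close> and \<open>ds/dr = 1 / \<rho>(s)\<close>, which turns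
  \<open>s\<^sup>N\<^sup>-\<^sup>1 \<rho>(s)\<^sup>N\<^sup>-\<^sup>2 f'(s)\<close> into \<open>sinh\<^sup>N\<^sup>-\<^sup>1 U'\<close>. The values of \<open>f\<close> are read off along a
  coordinate axis \<open>e\<close>, which passes smoothly through the origin; this makes the flux
  continuous there.
\<close>

lemma radial_poisson_of_hyp_laplacian:
  fixes u :: "'a::euclidean_space \<Rightarrow> real"
  assumes C2: "Ck_on 2 u (ball 0 1)" and radial: "radial_profile u U"
    and eq: "\<And>x. x \<in> ball 0 1 \<Longrightarrow> - hyp_laplacian u x = h (hyp_dist 0 x)"
    and dim: "DIM('a) = n + 2"
  obtains U' where "radial_poisson (n + 1) U U' h" and "(U \<longlongrightarrow> u 0) (at_right 0)"
proof -
  obtain e :: 'a where e: "e \<in> Basis" using nonempty_Basis by blast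
  have ne: "norm (s *\<^sub>R e) = \<bar>s\<bar>" for s using e by simp
  define f where "f = (\<lambda>s. u (s *\<^sub>R e))"
  define f' where "f' = (\<lambda>s. partial e u (s *\<^sub>R e))"
  have f': "(f has_real_derivative f' s) (at s)" if "\<bar>s\<bar> < 1" for s
    unfolding f_def f'_def using that e
    by (intro partial_has_real_derivative_line Ck_on_2_differentiable[OF C2]) auto
  define f'' where "f'' = (\<lambda>s. partial e (partial e u) (s *\<^sub>R e))"
  have f'': "(f' has_real_derivative f'' s) (at s)" if "\<bar>s\<bar> < 1" for s
    unfolding f'_def f''_def using that e
    by (intro partial_has_real_derivative_line Ck_on_2_differentiable[OF C2]) auto
  have uf: "u y = f (norm y)" if y: "y \<in> ball 0 1" for y
  proof -
    have "hyp_dist 0 (norm y *\<^sub>R e) = hyp_dist 0 y"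
      using e by (simp add: hyp_dist_def)
    moreover have "norm y *\<^sub>R e \<in> ball 0 1" using y e by simp
    ultimately show ?thesis using radial y unfolding radial_profile_def f_def by metis
  qed
  define T where "T = (\<lambda>r::real. tanh (r / 2))"
  have T: "\<bar>T r\<bar> < 1" "1 - (T r)\<^sup>2 > 0" for r
  proof -
    show "\<bar>T r\<bar> < 1" using tanh_real_bounds[of "r / 2"] by (auto simp: T_def)
    then show "1 - (T r)\<^sup>2 > 0" by (simp add: abs_square_less_1)
  qed
  have sinhT: "sinh r = T r * (2 / (1 - (T r)\<^sup>2))" for r
    unfolding T_def by (rule sinh_eq_tanh_half)
  have T0: "T r > 0" if "r > 0" for r using that by (simp add: T_def)
  have dT: "(T has_real_derivative (1 - (T r)\<^sup>2) / 2) (at r)" for r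
    unfolding T_def by (auto intro!: derivative_eq_intros)
  have Uf: "U r = f (T r)" if r: "r \<ge> 0" for r
  proof -
    have n: "norm (T r *\<^sub>R e) = tanh (r / 2)" using r ne[of "T r"] by (simp add: T_def)
    then have "hyp_dist 0 (T r *\<^sub>R e) = r" by (rule hyp_dist_eq)
    moreover have "T r *\<^sub>R e \<in> ball 0 1" by (simp only: mem_ball_0 ne T(1))
    ultimately show ?thesis using radial unfolding radial_profile_def f_def by metis
  qed
  define U' where "U' = (\<lambda>r. f' (T r) * ((1 - (T r)\<^sup>2) / 2))"
  define H where "H = (\<lambda>s. s ^ (n + 1) * (2 / (1 - s\<^sup>2)) ^ n * f' s)"
  have FH: "sinh r ^ (n + 1) * U' r = H (T r)" for r
    using T(2)[of r] unfolding sinhT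
    by (simp add: U'_def H_def power_mult_distrib power_divide)
  have "radial_poisson (n + 1) U U' h"
    unfolding radial_poisson_def FH
  proof (intro conjI allI impI)
    fix r :: real assume r: "r > 0"
    have "((\<lambda>r. f (T r)) has_real_derivative U' r) (at r)"
      unfolding U'_def by (rule DERIV_chain2[OF f'[OF T(1)] dT])
    then show "(U has_real_derivative U' r) (at r)"
      by (rule has_field_derivative_transform_within_open[where S = "{0<..}"]) (use r Uf in auto)
    define x where "x = T r *\<^sub>R e"
    have nx: "norm x = T r" using T0[OF r] ne[of "T r"] by (simp add: x_def)
    have x: "x \<in> ball 0 1" "x \<noteq> 0" using nx T(1)[of r] T0[OF r] by auto
    have dist: "hyp_dist 0 x = r" using nx by (intro hyp_dist_eq) (simp add: T_def)
    have "(H has_real_derivative T r ^ (n + 1) * hyp_factor x ^ (n + 2) * hyp_laplacian u x) (at (T r))"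
      unfolding H_def nx[symmetric]
      by (rule hyp_laplacian_radial_flux[where f = f and f'' = "f'' (norm x)"])
         (use uf f' f'' x dim in auto)
    from DERIV_chain2[OF this dT[of r]]
    have "((\<lambda>r. H (T r)) has_real_derivative
       T r ^ (n + 1) * hyp_factor x ^ (n + 2) * hyp_laplacian u x * ((1 - (T r)\<^sup>2) / 2)) (at r)" .
    also have "hyp_laplacian u x = - h r" using eq[OF x(1)] dist by simp
    also have "T r ^ (n + 1) * hyp_factor x ^ (n + 2) * - h r * ((1 - (T r)\<^sup>2) / 2) = - (sinh r ^ (n + 1) * h r)"
      using T(2)[of r] unfolding sinhT
      by (simp add: hyp_factor_def nx power_mult_distrib power_divide)
    finally show "((\<lambda>r. H (T r)) has_real_derivative - (sinh r ^ (n + 1) * h r)) (at r)" .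
  next
    have "isCont f' 0" using f''[of 0] DERIV_isCont by auto
    then have "isCont H 0" unfolding H_def by (intro continuous_intros) auto
    then have "isCont (\<lambda>r. H (T r)) 0"
      by (intro isCont_o2[OF DERIV_isCont[OF dT]]) (simp add: T_def)
    then have "((\<lambda>r. H (T r)) \<longlongrightarrow> H (T 0)) (at 0)" by (rule isContD)
    then show "((\<lambda>r. H (T r)) \<longlongrightarrow> 0) (at_right 0)"
      by (auto simp: T_def H_def intro: filterlim_mono at_le)
  qed
  moreover have "(U \<longlongrightarrow> u 0) (at_right 0)"
  proof -
    have "isCont (\<lambda>r. f (T r)) 0"
      by (rule isCont_o2[OF DERIV_isCont[OF dT] DERIV_isCont[OF f'[OF T(1)]]])
    then have "((\<lambda>r. f (T r)) \<longlongrightarrow> f (T 0)) (at 0)" by (rule isContD)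
    then have "((\<lambda>r. f (T r)) \<longlongrightarrow> u 0) (at_right 0)"
      by (auto simp: T_def f_def intro: filterlim_mono at_le)
    then show ?thesis
      by (rule Lim_transform_eventually)
         (auto simp: eventually_at_right_field Uf intro!: exI[of _ 1])
  qed
  ultimately show thesis by (rule that)
qed

section \<open>Square integrability and volume growth\<close>

lemma content_annulus_lower:
  assumes "0 \<le> t" "t \<le> 1"
  shows "measure lborel (ball 0 t - ball 0 (t\<^sup>2) :: 'a::euclidean_space set)
           \<ge> unit_ball_vol DIM('a) * t ^ DIM('a) * (1 - t)"
proof -
  let ?N = "DIM('a)"
  have t2: "t\<^sup>2 \<le> t" using assms by (simp add: power2_eq_square mult_left_le)
  have "(t\<^sup>2) ^ ?N = t ^ ?N * t ^ ?N" by (simp add: power2_eq_square power_mult_distrib)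
  also have "\<dots> \<le> t ^ ?N * t"
  proof -
    have "t ^ ?N \<le> t ^ 1" using assms by (intro power_decreasing) (auto simp: Suc_le_eq)
    then show ?thesis using assms by (intro mult_left_mono) auto
  qed
  finally have "t ^ ?N * (1 - t) \<le> t ^ ?N - (t\<^sup>2) ^ ?N" by (simp add: algebra_simps)
  then have "unit_ball_vol ?N * (t ^ ?N * (1 - t)) \<le> unit_ball_vol ?N * (t ^ ?N - (t\<^sup>2) ^ ?N)"
    by (intro mult_left_mono) auto
  also have "\<dots> = measure lborel (ball 0 t :: 'a set) - measure lborel (ball 0 (t\<^sup>2) :: 'a set)"
    using assms by (simp add: content_ball algebra_simps)
  also have "\<dots> = measure lborel (ball 0 t - ball 0 (t\<^sup>2) :: 'a set)"
    using t2 emeasure_lborel_ball_finite[of "0::'a" t]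
    by (subst measure_Diff) (auto simp: subset_ball)
  finally show ?thesis by (simp add: mult.assoc)
qed

text \<open>
  For nonincreasing \<open>U \<ge> 0\<close> and any set \<open>A\<close> inside the hyperbolic ball of radius \<open>r\<close>,
  \<open>U(r)\<^sup>2 vol(A) \<le> \<integral> u\<^sup>2\<close>. It suffices to find such sets with \<open>vol(A) \<ge> \<kappa> exp (n r)\<close>. With
  \<open>t = tanh (r / 2)\<close> the Euclidean annulus \<open>t\<^sup>2 \<le> |x| < t\<close> does: its Euclidean volume is of order
  \<open>1 - t\<close>, on it \<open>\<rho>\<close> is at least of order \<open>1 / (1 - t)\<close>, and \<open>1 - t\<close> is of order \<open>exp (- r)\<close>.
\<close>

lemma radial_square_integrable_decay:
  fixes u :: "'a::euclidean_space \<Rightarrow> real"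
  assumes int: "integrable hyp_measure (\<lambda>x. (u x)\<^sup>2)" and radial: "radial_profile u U"
    and pos: "\<And>r. r > 0 \<Longrightarrow> 0 \<le> U r"
    and antimono: "\<And>r s. 0 < r \<Longrightarrow> r \<le> s \<Longrightarrow> U s \<le> U r"
    and dim: "DIM('a) = n + 1"
  shows "\<exists>C. \<forall>r\<ge>1. U r \<le> C * exp (- (real n / 2) * r)"
proof -
  define I where "I = integral\<^sup>L hyp_measure (\<lambda>x. (u x)\<^sup>2)"
  have I0: "I \<ge> 0" by (simp add: I_def)
  define \<kappa> where "\<kappa> = unit_ball_vol (n + 1) * tanh (1 / 2 :: real) ^ (n + 1) / (2 ^ (n + 1) * 2 ^ n)"
  have \<kappa>: "\<kappa> > 0" by (simp add: \<kappa>_def)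
  have main: "\<kappa> * exp (real n * r) * (U r)\<^sup>2 \<le> I" if r: "r \<ge> 1" for r
  proof -
    define t where "t = tanh (r / 2)"
    have t: "0 < t" "t < 1" "tanh (1/2) \<le> t"
      using r tanh_real_lt_1[of "r/2"] by (auto simp: t_def)
    have t2: "t\<^sup>2 < t" using t by (simp add: power2_eq_square)
    define A :: "'a set" where "A = ball 0 t - ball 0 (t\<^sup>2)"
    have A_borel [measurable]: "A \<in> sets borel" by (simp add: A_def)
    have A_sub: "A \<subseteq> ball 0 1" using t by (auto simp: A_def)
    have meas_f: "(\<lambda>x::'a. ennreal (hyp_factor x ^ DIM('a))) \<in> borel_measurable (restrict_space lborel (ball 0 1))"
      unfolding hyp_factor_def by (intro measurable_restrict_space1) measurable
    have meas_u: "(\<lambda>x. ennreal ((u x)\<^sup>2)) \<in> borel_measurable (restrict_space lborel (ball 0 1))"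
      using borel_measurable_integrable[OF int] by (simp add: hyp_measure_def)
    define m where "m = (U r)\<^sup>2 * (1 / (2 * (1 - t))) ^ (n + 1)"
    have m0: "m \<ge> 0" using t by (simp add: m_def)
    have pointwise: "m \<le> hyp_factor x ^ DIM('a) * (u x)\<^sup>2" if x: "x \<in> A" for x
    proof -
      have nx: "t\<^sup>2 \<le> norm x" "norm x < t" using x by (auto simp: A_def)
      then have x1: "x \<in> ball 0 1" and x0: "norm x > 0" using t by (auto intro: less_le_trans[of 0 "t\<^sup>2"])
      have d: "norm x = tanh (hyp_dist 0 x / 2)" by (rule norm_eq_tanh_half_hyp_dist[OF x1])
      have "hyp_dist 0 x > 0" "hyp_dist 0 x \<le> r"
        using x0 nx(2) unfolding d t_def by auto
      from antimono[OF this] have "U r \<le> u x" using radial x1 by (auto simp: radial_profile_def)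
      then have U: "(U r)\<^sup>2 \<le> (u x)\<^sup>2" using pos[of r] r by (intro power_mono) auto
      have n1: "(norm x)\<^sup>2 < 1" using x1 by (simp add: abs_square_less_1)
      have "t ^ 4 \<le> (norm x)\<^sup>2" using nx power_mono[of "t\<^sup>2" "norm x" 2] by (simp flip: power_mult)
      then have "1 - (norm x)\<^sup>2 \<le> 1 - t ^ 4" by simp
      also have "\<dots> = (1 - t) * ((1 + t) * (1 + t\<^sup>2))" by (simp add: algebra_simps power2_eq_square power4_eq_xxxx)
      also have "\<dots> \<le> (1 - t) * (2 * 2)"
        using t t2 by (intro mult_left_mono mult_mono) auto
      finally have "2 / ((1 - t) * (2 * 2)) \<le> 2 / (1 - (norm x)\<^sup>2)"
        using n1 t by (intro divide_left_mono) auto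
      then have "1 / (2 * (1 - t)) \<le> hyp_factor x" by (simp add: hyp_factor_def divide_simps split: if_splits)
      then have "(1 / (2 * (1 - t))) ^ (n + 1) \<le> hyp_factor x ^ (n + 1)"
        using t by (intro power_mono) auto
      with U have "m \<le> (u x)\<^sup>2 * hyp_factor x ^ (n + 1)"
        unfolding m_def using t by (intro mult_mono) auto
      then show ?thesis by (simp add: dim mult.commute)
    qed
    have "ennreal (m * measure lborel A) = (\<integral>\<^sup>+x. ennreal m * indicator A x \<partial>lborel)"
    proof -
      have "emeasure lborel A < \<infinity>"
        using emeasure_mono[of A "ball 0 t" lborel] emeasure_lborel_ball_finite[of "0::'a" t]
        by (auto simp: A_def intro: le_less_trans)
      then show ?thesis using m0
        by (simp add: nn_integral_cmult_indicator ennreal_mult emeasure_eq_ennreal_measure)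
    qed
    also have "\<dots> \<le> (\<integral>\<^sup>+x. (ennreal (hyp_factor x ^ DIM('a)) * ennreal ((u x)\<^sup>2)) * indicator (ball 0 1) x \<partial>lborel)"
    proof (rule nn_integral_mono)
      fix x :: 'a
      show "ennreal m * indicator A x \<le> (ennreal (hyp_factor x ^ DIM('a)) * ennreal ((u x)\<^sup>2)) * indicator (ball 0 1) x"
        using A_sub pointwise[of x] by (auto simp: indicator_def ennreal_leI simp flip: ennreal_mult'')
    qed
    also have "\<dots> = (\<integral>\<^sup>+x. ennreal ((u x)\<^sup>2) \<partial>hyp_measure)"
      unfolding hyp_measure_def
      by (subst nn_integral_density[OF meas_f meas_u]) (simp add: nn_integral_restrict_space)
    also have "\<dots> = ennreal I" unfolding I_def by (rule nn_integral_eq_integral[OF int]) simp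
    finally have "m * measure lborel A \<le> I" using I0 by simp
    moreover have "\<kappa> * exp (real n * r) * (U r)\<^sup>2 \<le> m * measure lborel A"
    proof -
      have "1 - t = 2 / (exp r + 1)"
      proof -
        have "t = (1 - exp (- r)) / (1 + exp (- r))" by (simp add: t_def tanh_real_altdef)
        also have "1 - exp (- r) = exp (- r) * (exp r - 1)" by (simp add: algebra_simps flip: exp_add)
        also have "1 + exp (- r) = exp (- r) * (exp r + 1)" by (simp add: algebra_simps flip: exp_add)
        finally have "t = (exp r - 1) / (exp r + 1)" by simp
        moreover have "1 - (E - 1) / (E + 1) = 2 / (E + 1)" if "E > 0" for E :: real
          using that by (simp add: field_simps)
        ultimately show ?thesis by simp
      qed
      also have "\<dots> \<le> 2 / exp r" by (intro divide_left_mono) (auto simp: add_pos_pos)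
      finally have "exp r / 2 \<le> 1 / (1 - t)" using t by (simp add: field_simps)
      then have "(exp r / 2) ^ n \<le> (1 / (1 - t)) ^ n" by (intro power_mono) auto
      then have e: "exp (real n * r) / 2 ^ n \<le> 1 / (1 - t) ^ n"
        by (simp add: power_divide exp_of_nat_mult)
      have "\<kappa> * exp (real n * r) =
        unit_ball_vol (n + 1) / 2 ^ (n + 1) * (tanh (1 / 2) ^ (n + 1) * (exp (real n * r) / 2 ^ n))"
        by (simp add: \<kappa>_def)
      also have "\<dots> \<le> unit_ball_vol (n + 1) / 2 ^ (n + 1) * (t ^ (n + 1) * (1 / (1 - t) ^ n))"
        using e t by (intro mult_left_mono mult_mono power_mono) auto
      also have "\<dots> = (1 / (2 * (1 - t))) ^ (n + 1) * (unit_ball_vol (n + 1) * t ^ (n + 1) * (1 - t))"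
      proof -
        have "a / 2 ^ (n + 1) * (b * (1 / d ^ n)) = (1 / (2 * d)) ^ (n + 1) * (a * b * d)"
          if "d > 0" for a b d :: real
          using that by (simp add: power_divide power_mult_distrib)
        from this[of "1 - t"] t show ?thesis by simp
      qed
      also have "\<dots> \<le> (1 / (2 * (1 - t))) ^ (n + 1) * measure lborel A"
        using content_annulus_lower[of t, where 'a = 'a] t unfolding A_def dim
        by (intro mult_left_mono) auto
      finally have "\<kappa> * exp (real n * r) * (U r)\<^sup>2 \<le> (1 / (2 * (1 - t))) ^ (n + 1) * measure lborel A * (U r)\<^sup>2"
        by (rule mult_right_mono) simp
      then show ?thesis by (simp add: m_def mult_ac)
    qed
    ultimately show ?thesis by linarith
  qed
  have "U r \<le> sqrt (I / \<kappa>) * exp (- (real n / 2) * r)" if r: "r \<ge> 1" for r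
  proof (rule power2_le_imp_le)
    have "(U r)\<^sup>2 \<le> I / (\<kappa> * exp (real n * r))"
      using main[OF r] \<kappa> by (simp add: field_simps)
    also have "\<dots> = (sqrt (I / \<kappa>) * exp (- (real n / 2) * r))\<^sup>2"
      using I0 \<kappa> by (simp add: power_mult_distrib exp_minus field_simps flip: exp_of_nat_mult exp_double)
    finally show "(U r)\<^sup>2 \<le> (sqrt (I / \<kappa>) * exp (- (real n / 2) * r))\<^sup>2" .
  qed (use I0 \<kappa> in auto)
  then show ?thesis by blast
qed

section \<open>Asymptotics of positive radial solutions\<close>

lemma decaying_exp_limit:
  fixes y :: "real \<Rightarrow> real"
  assumes "\<forall>r\<ge>1. y r \<le> C * exp (- \<alpha> * r)" and "\<And>r. r > 0 \<Longrightarrow> 0 < y r" and "\<alpha> > 0"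
  shows "(y \<longlongrightarrow> 0) at_top"
proof (rule tendsto_sandwich)
  show "eventually (\<lambda>r. 0 \<le> y r) at_top"
    using eventually_gt_at_top[of 0] by eventually_elim (use assms(2) in force)
  show "eventually (\<lambda>r. y r \<le> C * exp (- \<alpha> * r)) at_top"
    using eventually_ge_at_top[of 1] by eventually_elim (use assms(1) in blast)
  have "((\<lambda>r. exp (- \<alpha> * r)) \<longlongrightarrow> 0) at_top" using assms(3) by real_asymp
  then show "((\<lambda>r. C * exp (- \<alpha> * r)) \<longlongrightarrow> 0) at_top" by (rule tendsto_mult_right_zero)
qed simp

theorem theorem1p2:
  fixes u v :: "'a::euclidean_space \<Rightarrow> real"
    and U V :: "real \<Rightarrow> real"
    and p q :: real
  assumes dim: "DIM('a) \<ge> 3"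
    and lower: "1 \<le> p" "1 \<le> q"
    and upper: "p \<le> (real DIM('a) + 2) / (real DIM('a) - 2)"
               "q \<le> (real DIM('a) + 2) / (real DIM('a) - 2)"
    and H1: "u \<in> hyp_H1" "v \<in> hyp_H1"
    and pos: "\<forall>x\<in>ball 0 1. u x > 0 \<and> v x > 0"
    and radial: "radial_profile u U" "radial_profile v V"
    and sol: "hyp_system_solution p q u v"
  shows "(\<forall>r>0. U differentiable (at r) \<and> V differentiable (at r) \<and>
                deriv U r < 0 \<and> deriv V r < 0) \<and>
         (U \<longlongrightarrow> 0) at_top \<and> (V \<longlongrightarrow> 0) at_top \<and>
         (deriv U \<longlongrightarrow> 0) at_top \<and> (deriv V \<longlongrightarrow> 0) at_top \<and>
         ((\<lambda>r. ln ((U r)\<^sup>2) / r) \<longlongrightarrow> - 2 * (real DIM('a) - 1)) at_top \<and>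
         ((\<lambda>r. ln ((V r)\<^sup>2) / r) \<longlongrightarrow> - 2 * (real DIM('a) - 1)) at_top \<and>
         ((\<lambda>r. ln ((deriv U r)\<^sup>2) / r) \<longlongrightarrow> - 2 * (real DIM('a) - 1)) at_top \<and>
         ((\<lambda>r. ln ((deriv V r)\<^sup>2) / r) \<longlongrightarrow> - 2 * (real DIM('a) - 1)) at_top"
proof -
  \<comment> \<open>The reduction to the radial equation is stated for dimension \<open>m + 2\<close>, so \<open>sinh\<close> carries the exponent \<open>m + 1\<close>.\<close>
  define m where "m = DIM('a) - 2"
  have m: "DIM('a) = m + 2" using dim by (simp add: m_def)
  have n: "m + 1 \<ge> 2" "real DIM('a) - 1 = real (m + 1)" using dim m by auto
  have profile_pos: "U r > 0" "V r > 0" if "r \<ge> 0" for r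
  proof -
    obtain e :: 'a where e: "e \<in> Basis" using nonempty_Basis by blast
    define x where "x = tanh (r / 2) *\<^sub>R e"
    have "norm x = tanh (r / 2)" using that e by (simp add: x_def)
    then have "hyp_dist 0 x = r" "x \<in> ball 0 1"
      using hyp_dist_eq[of x r] tanh_real_lt_1[of "r / 2"] by auto
    then show "U r > 0" "V r > 0" using radial pos by (auto simp: radial_profile_def)
  qed
  have equ: "- hyp_laplacian u x = V (hyp_dist 0 x) powr p" and
       eqv: "- hyp_laplacian v x = U (hyp_dist 0 x) powr q" if x: "x \<in> ball 0 1" for x
  proof -
    have pow: "\<bar>a\<bar> powr (s - 1) * a = a powr s" if "a > 0" for a s :: real
      using that by (simp add: powr_diff)
    have "u x > 0" "v x > 0" "U (hyp_dist 0 x) = u x" "V (hyp_dist 0 x) = v x"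
      using pos radial x by (auto simp: radial_profile_def)
    then show "- hyp_laplacian u x = V (hyp_dist 0 x) powr p" "- hyp_laplacian v x = U (hyp_dist 0 x) powr q"
      using sol x pow[of "u x" q] pow[of "v x" p] by (auto simp: hyp_system_solution_def)
  qed
  have C2: "Ck_on 2 u (ball 0 1)" "Ck_on 2 v (ball 0 1)"
    using sol by (auto simp: hyp_system_solution_def)
  obtain U' where U': "radial_poisson (m + 1) U U' (\<lambda>r. V r powr p)" "(U \<longlongrightarrow> u 0) (at_right 0)"
    using radial_poisson_of_hyp_laplacian[OF C2(1) radial(1) equ m] .
  obtain V' where V': "radial_poisson (m + 1) V V' (\<lambda>r. U r powr q)" "(V \<longlongrightarrow> v 0) (at_right 0)"
    using radial_poisson_of_hyp_laplacian[OF C2(2) radial(2) eqv m] .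
  have rhs_pos: "V r powr p > 0" "U r powr q > 0" if "r > 0" for r
    using profile_pos[of r] that by auto
  note U_anti = radial_poisson_antimono[OF U'(1) rhs_pos(1)]
  note V_anti = radial_poisson_antimono[OF V'(1) rhs_pos(2)]
  have bounded: "y r \<le> L" if "(y \<longlongrightarrow> L) (at_right 0)" "r > 0"
    "\<And>a b. 0 < a \<Longrightarrow> a \<le> b \<Longrightarrow> y b \<le> y a" for y :: "real \<Rightarrow> real" and L r
  proof (rule tendsto_lowerbound[OF that(1)])
    show "eventually (\<lambda>s. y r \<le> y s) (at_right 0)"
      unfolding eventually_at_right_field using that by (intro exI[of _ r]) auto
  qed simp
  define M where "M = max (u 0) (v 0)"
  have UM: "U r \<le> M" and VM: "V r \<le> M" if "r > 0" for r
    using bounded[OF U'(2) that U_anti] bounded[OF V'(2) that V_anti] by (auto simp: M_def)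
  have L2: "integrable hyp_measure (\<lambda>x. (u x)\<^sup>2)" "integrable hyp_measure (\<lambda>x. (v x)\<^sup>2)"
    using H1 by (auto simp: hyp_H1_def)
  have Udec: "\<exists>C. \<forall>r\<ge>1. U r \<le> C * exp (- (real (m + 1) / 2) * r)"
    using m profile_pos
    by (intro radial_square_integrable_decay[OF L2(1) radial(1) _ U_anti]) (auto intro: less_imp_le)
  have Vdec: "\<exists>C. \<forall>r\<ge>1. V r \<le> C * exp (- (real (m + 1) / 2) * r)"
    using m profile_pos
    by (intro radial_square_integrable_decay[OF L2(2) radial(2) _ V_anti]) (auto intro: less_imp_le)
  have lim: "(U \<longlongrightarrow> 0) at_top" "(V \<longlongrightarrow> 0) at_top"
    using Udec Vdec profile_pos
    by (elim exE; intro decaying_exp_limit[where \<alpha> = "real (m + 1) / 2"]; simp)+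
  have ppos: "0 < U r" "0 < V r" if "r > 0" for r using profile_pos that by auto
  note asymU = coupled_radial_asymptotics[OF U'(1) V'(1) ppos lower n(1) UM VM Udec Vdec lim]
  note asymV = coupled_radial_asymptotics[OF V'(1) U'(1) ppos(2,1) lower(2,1) n(1) VM UM Vdec Udec lim(2,1)]
  have DU: "(U has_real_derivative U' r) (at r)" and DV: "(V has_real_derivative V' r) (at r)" if "r > 0" for r
    using U'(1) V'(1) that by (auto simp: radial_poisson_def)
  have dU: "deriv U r = U' r" and dV: "deriv V r = V' r" if "r > 0" for r
    using DU DV that by (auto intro: DERIV_imp_deriv)
  \<comment> \<open>\<open>deriv U\<close> is controlled for positive arguments only.\<close>
  have ev: "eventually (\<lambda>r. U' r = deriv U r) at_top" "eventually (\<lambda>r. V' r = deriv V r) at_top"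
    using eventually_gt_at_top[of 0] by (eventually_elim, simp add: dU dV)+
  have ev_ln: "eventually (\<lambda>r. ln ((U' r)\<^sup>2) / r = ln ((deriv U r)\<^sup>2) / r) at_top"
    "eventually (\<lambda>r. ln ((V' r)\<^sup>2) / r = ln ((deriv V r)\<^sup>2) / r) at_top"
    using ev by (eventually_elim, simp)+
  have "\<forall>r>0. U differentiable (at r) \<and> V differentiable (at r) \<and> deriv U r < 0 \<and> deriv V r < 0"
    using DU DV dU dV radial_poisson_deriv_neg[OF U'(1) rhs_pos(1)]
      radial_poisson_deriv_neg[OF V'(1) rhs_pos(2)]
    by (auto simp: real_differentiable_def)
  then show ?thesis
    unfolding n(2)
    using lim asymU(2) asymV(2)
      Lim_transform_eventually[OF asymU(1) ev(1)] Lim_transform_eventually[OF asymV(1) ev(2)]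
      Lim_transform_eventually[OF asymU(3) ev_ln(1)] Lim_transform_eventually[OF asymV(3) ev_ln(2)]
    by simp
qed

end
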